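(* Let $G$ be a finite simple cubic graph (i.e. every vertex of $G$ has degree exactly $3$), not necessarily connected. Then the $2$-subdivision $S_2(G)$ of $G$ is strongly antimagic.
   Context: All graphs are finite and simple and are not required to be connected. For a graph $H$, $d_H(v)$ denotes the degree of a vertex $v$ in $H$, and for a positive integer $r$, $[r]=\{1,2,\ldots,r\}$. $2$-subdivision: $S_2(G)$ is the graph obtained from $G$ by subdividing every edge exactly twice, i.e. every edge $uv$ of $G$ is replaced by a path $u\,x\,y\,v$ of length three, where $x,y$ are two new vertices (distinct new vertices being used for distinct edges). Thus $S_2(G)$ has $3|E(G)|$ edges. Antimagic labeling: for a graph $H$ with $M$ edges, an antimagic labeling of $H$ is a bijection $f:E(H)\to[M]$ such that the vertex sums $\sigma_f(v)=\sum_{e\ni v}f(e)$ (the sum over the edges $e$ of $H$ incident with $v$), for $v\in V(H)$, are pairwise distinct. An antimagic labeling $f$ is strongly antimagic if, for all $u,v\in V(H)$, $d_H(u)<d_H(v)$ implies $\sigma_f(u)<\sigma_f(v)$. A graph is strongly antimagic if it admits a strongly antimagic labeling. *)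

theory Defs
  imports Main
begin

type_synonym 'a graph = "'a set \<times> 'a set set"

abbreviation verts :: "'a graph \<Rightarrow> 'a set" where
  "verts G \<equiv> fst G"

abbreviation edges :: "'a graph \<Rightarrow> 'a set set" where
  "edges G \<equiv> snd G"

definition simple_graph :: "'a graph \<Rightarrow> bool" where
  "simple_graph G \<longleftrightarrow> finite (verts G) \<and> (\<forall>e\<in>edges G. e \<subseteq> verts G \<and> card e = 2)"

definition incident_edges :: "'a graph \<Rightarrow> 'a \<Rightarrow> 'a set set" where
  "incident_edges G v = {e \<in> edges G. v \<in> e}"

definition degree :: "'a graph \<Rightarrow> 'a \<Rightarrow> nat" where
  "degree G v = card (incident_edges G v)"

definition cubic :: "'a graph \<Rightarrow> bool" where
  "cubic G \<longleftrightarrow> (\<forall>v\<in>verts G. degree G v = 3)"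

text \<open>For an edge uv, the constructor term Sub u v is the subdividing vertex
  adjacent to u, and Sub v u is the one adjacent to v, so that uv is replaced by
  the path Orig u, Sub u v, Sub v u, Orig v.\<close>

datatype 'a subdiv_vertex = Orig 'a | Sub 'a 'a

definition subdivision2 :: "'a graph \<Rightarrow> 'a subdiv_vertex graph" where
  "subdivision2 G =
    (Orig ` verts G \<union> {Sub u v | u v. {u, v} \<in> edges G},
     {{Orig u, Sub u v} | u v. {u, v} \<in> edges G} \<union>
     {{Sub u v, Sub v u} | u v. {u, v} \<in> edges G})"

definition vertex_sum :: "'a graph \<Rightarrow> ('a set \<Rightarrow> nat) \<Rightarrow> 'a \<Rightarrow> nat" where
  "vertex_sum G f v = (\<Sum>e\<in>incident_edges G v. f e)"

definition antimagic_labeling :: "'a graph \<Rightarrow> ('a set \<Rightarrow> nat) \<Rightarrow> bool" where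
  "antimagic_labeling G f \<longleftrightarrow>
     bij_betw f (edges G) {1..card (edges G)} \<and> inj_on (vertex_sum G f) (verts G)"

definition strongly_antimagic_labeling :: "'a graph \<Rightarrow> ('a set \<Rightarrow> nat) \<Rightarrow> bool" where
  "strongly_antimagic_labeling G f \<longleftrightarrow> antimagic_labeling G f \<and>
     (\<forall>u\<in>verts G. \<forall>v\<in>verts G.
        degree G u < degree G v \<longrightarrow> vertex_sum G f u < vertex_sum G f v)"

definition strongly_antimagic :: "'a graph \<Rightarrow> bool" where
  "strongly_antimagic G \<longleftrightarrow> (\<exists>f. strongly_antimagic_labeling G f)"

lemma finite_edges: "simple_graph G \<Longrightarrow> finite (edges G)"
  unfolding simple_graph_def by (rule finite_subset[of _ "Pow (verts G)"]) auto

lemma simple_graph_subdivision2: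
  assumes "simple_graph G"
  shows "simple_graph (subdivision2 G)"
proof -
  have *: "u \<in> verts G \<and> v \<in> verts G \<and> u \<noteq> v" if "{u, v} \<in> edges G" for u v
    using assms that by (cases "u = v") (force simp: simple_graph_def)+
  have "{Sub u v | u v. {u, v} \<in> edges G} \<subseteq> (\<lambda>(u, v). Sub u v) ` (verts G \<times> verts G)"
    using * by force
  then have "finite {Sub u v | u v. {u, v} \<in> edges G}"
    using assms by (rule_tac finite_subset) (auto simp: simple_graph_def)
  then show ?thesis
    using assms * by (fastforce simp: simple_graph_def subdivision2_def insert_commute)
qed

lemma card_edges_subdivision2:
  assumes "simple_graph G"
  shows "card (edges (subdivision2 G)) = 3 * card (edges G)"
proof -
  define P where "P e = {{Orig u, Sub u v} | u v. {u, v} = e} \<union> {{Sub u v, Sub v u} | u v. {u, v} = e}"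
    for e :: "'a set"
  have edges_eq: "edges (subdivision2 G) = (\<Union>e\<in>edges G. P e)"
  proof (intro equalityI subsetI)
    fix x assume "x \<in> edges (subdivision2 G)"
    then obtain u v where "{u, v} \<in> edges G" "x = {Orig u, Sub u v} \<or> x = {Sub u v, Sub v u}"
      unfolding subdivision2_def by auto
    moreover from this(2) have "x \<in> P {u, v}"
      unfolding P_def by blast
    ultimately show "x \<in> (\<Union>e\<in>edges G. P e)"
      by (rule_tac UN_I)
  next
    fix x assume "x \<in> (\<Union>e\<in>edges G. P e)"
    then show "x \<in> edges (subdivision2 G)"
      unfolding subdivision2_def P_def by auto
  qed
  have P_eq: "P {a, b} = {{Orig a, Sub a b}, {Sub a b, Sub b a}, {Orig b, Sub b a}}" for a b
    by (auto simp: P_def doubleton_eq_iff)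
  have P_card: "card (P e) = 3 \<and> finite (P e)" if e: "e \<in> edges G" for e
  proof -
    from e assms obtain a b where "e = {a, b}" "a \<noteq> b"
      by (auto simp: simple_graph_def card_2_iff)
    then show ?thesis by (simp add: P_eq doubleton_eq_iff)
  qed
  have P_disjoint: "P e \<inter> P e' = {}" if "e \<noteq> e'" for e e'
  proof -
    have "(\<exists>u v. Sub u v \<in> x) \<and> (\<forall>u v. Sub u v \<in> x \<longrightarrow> {u, v} = d)" if "x \<in> P d" for x d
      using that by (auto simp: P_def insert_commute)
    then show ?thesis
      using that by blast
  qed
  have "card (\<Union>e\<in>edges G. P e) = (\<Sum>e\<in>edges G. card (P e))"
    by (rule card_UN_disjoint) (simp_all add: finite_edges[OF assms] P_card P_disjoint)
  then show ?thesis
    by (simp add: edges_eq P_card)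
qed

end

theory Submission
  imports Defs
begin

text \<open>The edges of \<open>G\<close> can be listed and oriented as \<open>e\<^sub>0, e\<^sub>1, \<dots>\<close> so that every vertex \<open>v\<close> is a
  junction: for some \<open>t\<close>, \<open>e\<^sub>t\<close> ends in \<open>v\<close> and \<open>e\<^bsub>t+1\<^esub>\<close> starts in \<open>v\<close>. Such a listing is a
  concatenation of trails, and if \<open>v\<close> is not a junction, then the three edges at \<open>v\<close> are ends of
  trails, two of which can be joined at \<open>v\<close>.

  With \<open>m\<close> edges, give the two outer parts of \<open>e\<^sub>0, e\<^sub>1, e\<^sub>2, e\<^sub>3, \<dots>\<close>, in the order in which they are
  traversed, the labels \<open>m\<close> plus \<open>1, 2 | 2m, 2m-1 | 3, 4 | 2m-2, 2m-3 | \<dots>\<close>, and give the middle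
  part the label \<open>z\<close> when the outer ones are \<open>m+2z-1\<close> and \<open>m+2z\<close>. The sums at the vertices of
  degree 2 are then \<open>m+3z-1\<close> and \<open>m+3z\<close>, hence distinct and at most \<open>4m\<close>. At a junction the two
  labels always add up to \<open>4m+2\<close>, so the sum at a vertex of degree 3 is \<open>4m+2\<close> plus its third label,
  and these are distinct as well.\<close>

section \<open>Listings of edges in which every vertex is a junction\<close>

definition uedge :: "'a \<times> 'a \<Rightarrow> 'a set" where
  "uedge a = {fst a, snd a}"

definition junctions :: "('a \<times> 'a) list \<Rightarrow> 'a set" where
  "junctions xs = {v. \<exists>t. Suc t < length xs \<and> snd (xs ! t) = v \<and> fst (xs ! Suc t) = v}"

definition reverse_trail :: "('a \<times> 'a) list \<Rightarrow> ('a \<times> 'a) list" where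
  "reverse_trail xs = map prod.swap (rev xs)"

text \<open>Consecutive arcs need not meet: every order and orientation is allowed, and trails are
  visible only through \<open>junctions\<close>.\<close>

definition edge_listing :: "'a set set \<Rightarrow> ('a \<times> 'a) list \<Rightarrow> bool" where
  "edge_listing E xs \<longleftrightarrow> distinct (map uedge xs) \<and> uedge ` set xs = E"

lemma uedge_swap [simp]: "uedge (prod.swap a) = uedge a"
  by (auto simp: uedge_def)

lemma junctions_Nil [simp]: "junctions [] = {}"
  by (simp add: junctions_def)

lemma junctions_Cons:
  "junctions (a # xs) = junctions xs \<union> {v. xs \<noteq> [] \<and> snd a = v \<and> fst (hd xs) = v}"
proof -
  have "(\<exists>t. Suc t < length (a # xs) \<and> snd ((a # xs) ! t) = v \<and> fst ((a # xs) ! Suc t) = v) \<longleftrightarrow>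
    (xs \<noteq> [] \<and> snd a = v \<and> fst (hd xs) = v) \<or>
    (\<exists>t. Suc t < length xs \<and> snd (xs ! t) = v \<and> fst (xs ! Suc t) = v)" for v
  proof -
    have "(\<exists>t. P t) \<longleftrightarrow> P 0 \<or> (\<exists>t. P (Suc t))" for P :: "nat \<Rightarrow> bool"
      by (metis not0_implies_Suc)
    from this[of "\<lambda>t. Suc t < length (a # xs) \<and> snd ((a # xs) ! t) = v \<and> fst ((a # xs) ! Suc t) = v"]
    show ?thesis by (cases xs) auto
  qed
  then show ?thesis
    unfolding junctions_def by blast
qed

lemma junctions_append:
  "junctions (xs @ ys) = junctions xs \<union> junctions ys \<union>
     {v. xs \<noteq> [] \<and> ys \<noteq> [] \<and> snd (last xs) = v \<and> fst (hd ys) = v}"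
  by (induction xs) (auto simp: junctions_Cons)

text \<open>Reversing the order and swapping each arc exchanges heads with tails, so neighbouring
  arcs still meet head to tail at the same vertex.\<close>

lemma junctions_reverse_trail [simp]: "junctions (reverse_trail xs) = junctions xs"
  by (induction xs)
     (auto simp: reverse_trail_def junctions_append junctions_Cons last_map last_rev)

lemma reverse_trail_eq_Nil_iff [simp]: "reverse_trail xs = [] \<longleftrightarrow> xs = []"
  by (simp add: reverse_trail_def)

lemma hd_reverse_trail: "xs \<noteq> [] \<Longrightarrow> hd (reverse_trail xs) = prod.swap (last xs)"
  by (simp add: reverse_trail_def hd_map hd_rev)

lemma last_reverse_trail: "xs \<noteq> [] \<Longrightarrow> last (reverse_trail xs) = prod.swap (hd xs)"
  by (simp add: reverse_trail_def last_map last_rev)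

section \<open>Cutting and regluing listings\<close>

lemma edge_listing_reverse_middle:
  "edge_listing E (A @ B @ C) \<Longrightarrow> edge_listing E (A @ reverse_trail B @ C)"
  by (auto simp: edge_listing_def reverse_trail_def rev_map[symmetric] image_Un image_image o_def)

lemma edge_listing_exchange:
  "edge_listing E (A @ B @ C) \<Longrightarrow> edge_listing E (B @ A @ C)"
  by (auto simp: edge_listing_def image_Un)

lemma junctions_append_superset: "junctions xs \<union> junctions ys \<subseteq> junctions (xs @ ys)"
  by (auto simp: junctions_append)

text \<open>Cutting a listing next to an arc end \<open>v\<close> can destroy only the junction
  \<open>v\<close>, which the regluing will restore.\<close>

lemma junctions_append_subset:
  "snd (last xs) = v \<or> fst (hd ys) = v \<Longrightarrow>
     junctions (xs @ ys) \<subseteq> insert v (junctions xs \<union> junctions ys)"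
  by (auto simp: junctions_append)

lemma junction_append:
  "xs \<noteq> [] \<Longrightarrow> ys \<noteq> [] \<Longrightarrow> snd (last xs) = v \<Longrightarrow> fst (hd ys) = v \<Longrightarrow> v \<in> junctions (xs @ ys)"
  by (auto simp: junctions_append)

text \<open>Both cuts are made at an end \<open>v\<close> of \<open>a\<close> or \<open>b\<close>,
  so no other junction is lost; reversing or moving a block then places the two arcs head to tail at
  \<open>v\<close>.\<close>

lemma junctions_join:
  assumes xs: "edge_listing E xs" and split: "xs = X @ a # Y @ b # Z"
    and good: "snd a = v \<or> fst b = v" "snd a = v \<or> fst a = v" "snd b = v \<or> fst b = v"
  shows "\<exists>ys. edge_listing E ys \<and> insert v (junctions xs) \<subseteq> junctions ys"
proof -
  consider "snd a = v" "snd b = v" | "fst a = v" "fst b = v" | "snd a = v" "fst b = v"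
    using good by auto
  then show ?thesis
  proof cases
    case 1
    \<comment> \<open>Reversing \<open>?B\<close> brings \<open>b\<close>, now starting in
      \<open>v\<close>, directly after \<open>a\<close>.\<close>
    let ?A = "X @ [a]" and ?B = "Y @ [b]"
    have eq: "xs = ?A @ ?B @ Z"
      by (simp add: split)
    have "junctions xs \<subseteq> insert v (junctions ?A \<union> junctions ?B \<union> junctions Z)"
      unfolding eq using junctions_append_subset[of ?A v "?B @ Z"]
        junctions_append_subset[of ?B v Z] 1 by auto
    moreover have "junctions ?A \<union> junctions ?B \<union> junctions Z \<subseteq> junctions (?A @ reverse_trail ?B @ Z)"
      using junctions_append_superset[of ?A "reverse_trail ?B @ Z"]
        junctions_append_superset[of "reverse_trail ?B" Z] by auto
    moreover have "v \<in> junctions (?A @ reverse_trail ?B @ Z)"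
      by (rule junction_append) (simp_all add: 1 hd_append hd_reverse_trail)
    moreover have "edge_listing E (?A @ reverse_trail ?B @ Z)"
      using xs unfolding eq by (rule edge_listing_reverse_middle)
    ultimately show ?thesis by blast
  next
    case 2
    \<comment> \<open>Reversing \<open>?B\<close> brings \<open>a\<close>, now ending in
      \<open>v\<close>, directly before \<open>b\<close>.\<close>
    let ?B = "a # Y" and ?C = "b # Z"
    have eq: "xs = X @ ?B @ ?C"
      by (simp add: split)
    have "junctions xs \<subseteq> insert v (junctions X \<union> junctions ?B \<union> junctions ?C)"
      unfolding eq using junctions_append_subset[of X v "?B @ ?C"]
        junctions_append_subset[of ?B v ?C] 2 by auto
    moreover have "junctions X \<union> junctions ?B \<union> junctions ?C \<subseteq> junctions ((X @ reverse_trail ?B) @ ?C)"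
      using junctions_append_superset[of "X @ reverse_trail ?B" ?C]
        junctions_append_superset[of X "reverse_trail ?B"] by auto
    moreover have "v \<in> junctions ((X @ reverse_trail ?B) @ ?C)"
      by (rule junction_append) (simp_all add: 2 last_reverse_trail)
    moreover have "edge_listing E ((X @ reverse_trail ?B) @ ?C)"
      using xs edge_listing_reverse_middle[of E X ?B ?C] unfolding eq append_assoc by blast
    ultimately show ?thesis by blast
  next
    case 3
    \<comment> \<open>Moving \<open>Y\<close> to the front closes the gap between \<open>a\<close>
      and \<open>b\<close>.\<close>
    let ?A = "X @ [a]" and ?C = "b # Z"
    have eq: "xs = ?A @ Y @ ?C"
      by (simp add: split)
    have "junctions xs \<subseteq> insert v (junctions ?A \<union> junctions Y \<union> junctions ?C)"
      unfolding eq using junctions_append_subset[of ?A v "Y @ ?C"]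
        junctions_append_subset[of Y v ?C] 3 by auto
    moreover have "junctions ?A \<union> junctions Y \<union> junctions ?C \<subseteq> junctions ((Y @ ?A) @ ?C)"
      using junctions_append_superset[of "Y @ ?A" ?C] junctions_append_superset[of Y ?A] by auto
    moreover have "v \<in> junctions ((Y @ ?A) @ ?C)"
      by (rule junction_append) (simp_all add: 3)
    moreover have "edge_listing E ((Y @ ?A) @ ?C)"
      using xs edge_listing_exchange[of E ?A Y ?C] unfolding eq append_assoc by blast
    ultimately show ?thesis by blast
  qed
qed

section \<open>Turning all vertices into junctions\<close>

lemma split_list_two:
  assumes "i < j" "j < length xs"
  shows "\<exists>X Y Z. xs = X @ xs ! i # Y @ xs ! j # Z"
proof -
  have "xs = take j xs @ xs ! j # drop (Suc j) xs"
    using assms by (simp add: id_take_nth_drop)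
  moreover have "take j xs = take i (take j xs) @ take j xs ! i # drop (Suc i) (take j xs)"
    using assms by (intro id_take_nth_drop) simp
  ultimately show ?thesis
    using assms by (metis append.assoc append_Cons nth_take)
qed

lemma junctions_extend:
  assumes xs: "edge_listing E xs" and deg: "card {e \<in> E. v \<in> e} = 3"
  shows "\<exists>ys. edge_listing E ys \<and> insert v (junctions xs) \<subseteq> junctions ys"
proof -
  let ?I = "{i. i < length xs \<and> v \<in> uedge (xs ! i)}"
  have "{e \<in> E. v \<in> e} = (\<lambda>i. uedge (xs ! i)) ` ?I"
    using xs by (auto simp: edge_listing_def set_conv_nth)
  moreover have "card ((\<lambda>i. uedge (xs ! i)) ` ?I) \<le> card ?I"
    by (rule card_image_le) simp
  ultimately have "3 \<le> card ?I"
    using deg by simp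
  then obtain I where I: "I \<subseteq> ?I" "card I = 3"
    by (rule obtain_subset_with_card_n)
  then obtain i j k where "I = {i, j, k}" "i < j" "j < k"
  proof -
    define l where "l = sorted_list_of_set I"
    have "finite I" using I(2) card.infinite by fastforce
    then have "length l = 3" "set l = I" "sorted_wrt (<) l"
      using I(2) by (simp_all add: l_def)
    moreover from this obtain i j k where "l = [i, j, k]"
      by (auto simp: numeral_3_eq_3 length_Suc_conv)
    ultimately show ?thesis
      using that by force
  qed
  with I(1) have idx: "i < j" "j < k" "k < length xs"
    and mem: "v \<in> uedge (xs ! i)" "v \<in> uedge (xs ! j)" "v \<in> uedge (xs ! k)"
    by auto
  \<comment> \<open>Only an edge leaving \<open>v\<close> followed by one entering \<open>v\<close> cannot be joined, as both may be
    ends of the same closed trail; among three edges some pair avoids this.\<close>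
  have join: ?thesis if pq: "p < q" "q < length xs" "v \<in> uedge (xs ! p)" "v \<in> uedge (xs ! q)"
    "snd (xs ! p) = v \<or> fst (xs ! q) = v" for p q
  proof -
    obtain X Y Z where "xs = X @ xs ! p # Y @ xs ! q # Z"
      using split_list_two[OF pq(1,2)] by auto
    moreover have "snd (xs ! p) = v \<or> fst (xs ! p) = v" "snd (xs ! q) = v \<or> fst (xs ! q) = v"
      using pq(3,4) by (auto simp: uedge_def)
    ultimately show ?thesis
      using junctions_join[OF xs _ pq(5)] by simp
  qed
  show ?thesis
  \<comment> \<open>The middle edge decides: entering \<open>v\<close>, it is joined with the later
    edge; leaving \<open>v\<close>, with the earlier one.\<close>
  proof (cases "snd (xs ! j) = v")
    case True
    then show ?thesis using join[of j k] idx mem by simp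
  next
    case False
    then show ?thesis using join[of i j] idx mem by (auto simp: uedge_def)
  qed
qed

lemma ex_edge_listing:
  assumes "simple_graph G"
  shows "\<exists>xs. edge_listing (edges G) xs"
proof -
  obtain es where es: "set es = edges G" "distinct es"
    using finite_distinct_list[OF finite_edges[OF assms]] by blast
  have "\<forall>e\<in>edges G. \<exists>a. uedge a = e"
    using assms by (fastforce simp: simple_graph_def card_2_iff uedge_def)
  then obtain g where g: "\<And>e. e \<in> edges G \<Longrightarrow> uedge (g e) = e"
    by metis
  have "map uedge (map g es) = es"
    using es g by (auto intro!: map_idI)
  then have "edge_listing (edges G) (map g es)"
    using es by (metis edge_listing_def list.set_map)
  then show ?thesis ..
qed

text \<open>Each use of \<open>junctions_extend\<close> keeps the junctions already gained, so an
  arbitrary listing can be improved one vertex at a time.\<close>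

lemma ex_edge_listing_all_junctions:
  assumes "simple_graph G" "cubic G"
  shows "\<exists>xs. edge_listing (edges G) xs \<and> verts G \<subseteq> junctions xs"
proof -
  have "\<exists>xs. edge_listing (edges G) xs \<and> W \<subseteq> junctions xs" if "W \<subseteq> verts G" for W
  proof -
    have "finite W"
      using assms(1) that finite_subset by (auto simp: simple_graph_def)
    then show ?thesis using that
    proof (induction W)
      case empty
      then show ?case using ex_edge_listing[OF assms(1)] by simp
    next
      case (insert v W)
      then obtain xs where xs: "edge_listing (edges G) xs" "W \<subseteq> junctions xs"
        by auto
      have "card {e \<in> edges G. v \<in> e} = 3"
        using assms(2) insert.prems by (auto simp: cubic_def degree_def incident_edges_def)
      then show ?case
        using junctions_extend[OF xs(1), of v] xs by blast
    qed
  qed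
  then show ?thesis by blast
qed

section \<open>Labels of the outer and middle parts\<close>

text \<open>The part of the edge \<open>uv\<close> at \<open>u\<close> has label \<open>m + 2 * Z {u, v} - b u v\<close>.\<close>

definition zigzag :: "nat \<Rightarrow> nat \<Rightarrow> nat" where
  "zigzag m t = (if even t then t div 2 + 1 else m - t div 2)"

lemma zigzag_range: "t < m \<Longrightarrow> zigzag m t \<in> {1..m}"
  by (auto simp: zigzag_def)

text \<open>Even positions count up from 1 and odd ones down from \<open>m\<close>; on positions
  below \<open>m\<close> the two runs do not meet.\<close>

lemma inj_on_zigzag: "inj_on (zigzag m) {..<m}"
proof (rule inj_onI)
  fix s t assume *: "s \<in> {..<m}" "t \<in> {..<m}" "zigzag m s = zigzag m t"
  have "s = 2 * (s div 2) \<or> s = 2 * (s div 2) + 1" "t = 2 * (t div 2) \<or> t = 2 * (t div 2) + 1"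
    by presburger+
  then obtain i j where "s = 2 * i \<or> s = 2 * i + 1" "t = 2 * j \<or> t = 2 * j + 1"
    by blast
  then show "s = t"
    using * by (elim disjE) (simp_all add: zigzag_def)
qed

text \<open>The \<open>zigzag\<close> values at \<open>t\<close> and \<open>Suc t\<close> add up to
  \<open>m + 1\<close> for even \<open>t\<close> and to \<open>m + 2\<close> for odd
  \<open>t\<close>. At the junction both values of \<open>b\<close> are 0 in the first case and 1 in
  the second, which absorbs the difference.\<close>

lemma ex_balanced_labels:
  assumes simple: "simple_graph G" and xs: "edge_listing (edges G) xs" "verts G \<subseteq> junctions xs"
  defines "m \<equiv> card (edges G)"
  shows "\<exists>Z (b :: 'a \<Rightarrow> 'a \<Rightarrow> nat).
    inj_on Z (edges G) \<and> Z ` edges G \<subseteq> {1..m} \<and>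
    (\<forall>u v. {u, v} \<in> edges G \<longrightarrow> b u v + b v u = 1) \<and>
    (\<forall>v\<in>verts G. \<exists>u w. u \<noteq> w \<and> {v, u} \<in> edges G \<and> {v, w} \<in> edges G \<and>
       2 * Z {v, u} + 2 * Z {v, w} = 2 * m + 2 + b v u + b v w)"
proof -
  have len: "length xs = m"
    using xs(1) unfolding m_def edge_listing_def
    by (metis distinct_card length_map list.set_map)
  have neq: "u \<noteq> v" if "{u, v} \<in> edges G" for u v
    using simple that by (force simp: simple_graph_def)
  define pos where "pos e = (THE t. t < m \<and> uedge (xs ! t) = e)" for e
  have pos_eq: "pos (uedge (xs ! t)) = t" if "t < m" for t
    unfolding pos_def using that xs(1) len
    by (intro the_equality) (auto simp: edge_listing_def distinct_conv_nth)
  have mem: "uedge (xs ! t) \<in> edges G" if "t < m" for t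
    using that xs(1) len by (auto simp: edge_listing_def)
  have pos: "pos e < m \<and> uedge (xs ! pos e) = e" if "e \<in> edges G" for e
  proof -
    have "e \<in> uedge ` set xs"
      using that xs(1) by (simp add: edge_listing_def)
    then obtain t where "t < m" "uedge (xs ! t) = e"
      by (auto simp: set_conv_nth len)
    then show ?thesis
      using pos_eq by auto
  qed
  define Z where "Z e = zigzag m (pos e)" for e
  \<comment> \<open>The value 1 marks the end with the smaller outer label: the starting end at even
    positions, the final end at odd ones.\<close>
  define b :: "'a \<Rightarrow> 'a \<Rightarrow> nat" where
    "b u v = (if even (pos {u, v}) \<longleftrightarrow> xs ! pos {u, v} = (u, v) then 1 else 0)" for u v
  have "inj_on pos (edges G)"
    using pos by (metis inj_onI)
  then have "inj_on Z (edges G)"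
    using inj_on_zigzag[of m] pos unfolding Z_def inj_on_def by simp
  moreover have "Z ` edges G \<subseteq> {1..m}"
    using zigzag_range pos by (auto simp: Z_def simp del: atLeastAtMost_iff)
  moreover have "b u v + b v u = 1" if e: "{u, v} \<in> edges G" for u v
  proof -
    have "xs ! pos {u, v} = (u, v) \<or> xs ! pos {u, v} = (v, u)"
      using pos[OF e] by (cases "xs ! pos {u, v}") (auto simp: uedge_def doubleton_eq_iff)
    then show ?thesis
      using neq[OF e] by (auto simp: b_def insert_commute)
  qed
  moreover have "\<exists>u w. u \<noteq> w \<and> {v, u} \<in> edges G \<and> {v, w} \<in> edges G \<and>
       2 * Z {v, u} + 2 * Z {v, w} = 2 * m + 2 + b v u + b v w" if "v \<in> verts G" for v
  proof -
    from that xs(2) len obtain t where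
      t: "Suc t < m" "snd (xs ! t) = v" "fst (xs ! Suc t) = v"
      by (auto simp: junctions_def)
    define u w where "u = fst (xs ! t)" and "w = snd (xs ! Suc t)"
    have arcs: "xs ! t = (u, v)" "xs ! Suc t = (v, w)"
      using t by (simp_all add: u_def w_def prod_eq_iff)
    have e: "uedge (xs ! t) = {v, u}" "uedge (xs ! Suc t) = {v, w}"
      by (auto simp: arcs uedge_def)
    have p: "pos {v, u} = t" "pos {v, w} = Suc t"
      using pos_eq[of t] pos_eq[of "Suc t"] t(1) e by auto
    have E: "{v, u} \<in> edges G" "{v, w} \<in> edges G"
      using mem[of t] mem[of "Suc t"] t(1) e by auto
    \<comment> \<open>Otherwise one edge would have the two positions \<open>t\<close> and
      \<open>Suc t\<close>.\<close>
    have "u \<noteq> w"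
      using p by auto
    moreover have "2 * Z {v, u} + 2 * Z {v, w} = 2 * m + 2 + b v u + b v w"
    proof -
      have b: "b v u = (if even t then 0 else 1)" "b v w = (if even t then 0 else 1)"
        using neq[OF E(1)] by (auto simp: b_def p arcs)
      show ?thesis
        using t(1) unfolding Z_def p b zigzag_def by (auto elim!: evenE oddE)
    qed
    ultimately show ?thesis using E by blast
  qed
  ultimately show ?thesis by blast
qed

section \<open>The labeling of the 2-subdivision\<close>

lemma incident_edges_Orig:
  "incident_edges (subdivision2 G) (Orig v) = (\<lambda>x. {Orig v, Sub v x}) ` {x. {v, x} \<in> edges G}"
  by (auto simp: incident_edges_def subdivision2_def)

lemma incident_edges_Sub:
  assumes "{u, v} \<in> edges G"
  shows "incident_edges (subdivision2 G) (Sub u v) = {{Orig u, Sub u v}, {Sub u v, Sub v u}}"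
proof -
  have "{Sub v u, Sub u v} = {Sub u v, Sub v u}" "{v, u} \<in> edges G"
    using assms by (auto simp: insert_commute)
  then show ?thesis
    using assms by (auto simp: incident_edges_def subdivision2_def)
qed

lemma card_neighbours:
  assumes "simple_graph G"
  shows "card {x. {v, x} \<in> edges G} = degree G v"
proof -
  have "\<exists>x. e = {v, x}" if "e \<in> edges G" "v \<in> e" for e
  proof -
    from assms that(1) obtain a b where "e = {a, b}"
      by (auto simp: simple_graph_def card_2_iff)
    then show ?thesis using that(2) by auto
  qed
  then have "incident_edges G v = (\<lambda>x. {v, x}) ` {x. {v, x} \<in> edges G}"
    by (auto simp: incident_edges_def)
  moreover have "inj_on (\<lambda>x. {v, x}) {x. {v, x} \<in> edges G}"
    by (auto simp: inj_on_def doubleton_eq_iff)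
  ultimately show ?thesis
    by (simp add: degree_def card_image)
qed

text \<open>The listing is no longer visible here: it is enough that at each vertex two of the three
  outer labels have the constant sum \<open>4 * m + 2\<close>, so that the third one identifies the
  vertex.\<close>

lemma strongly_antimagic_if_balanced_labels:
  fixes Z :: "'a set \<Rightarrow> nat" and b :: "'a \<Rightarrow> 'a \<Rightarrow> nat"
  assumes simple: "simple_graph G" and cubic: "cubic G"
  defines "m \<equiv> card (edges G)"
  assumes Z: "inj_on Z (edges G)" "Z ` edges G \<subseteq> {1..m}"
    and b: "\<And>u v. {u, v} \<in> edges G \<Longrightarrow> b u v + b v u = 1"
    and balanced: "\<And>v. v \<in> verts G \<Longrightarrow> \<exists>u w. u \<noteq> w \<and> {v, u} \<in> edges G \<and> {v, w} \<in> edges G \<and>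
       2 * Z {v, u} + 2 * Z {v, w} = 2 * m + 2 + b v u + b v w"
  shows "strongly_antimagic (subdivision2 G)"
proof -
  let ?H = "subdivision2 G"
  \<comment> \<open>On edges \<open>1 \<le> Z\<close> and \<open>b \<le> 1\<close>, so the
    subtraction never truncates.\<close>
  define L where "L u v = m + 2 * Z {u, v} - b u v" for u v
  \<comment> \<open>An outer edge determines \<open>u\<close> and \<open>v\<close>, a middle edge
    determines \<open>{u, v}\<close>, and no set has both forms, so the described value is
    unique.\<close>
  define f where "f s = (THE n. (\<exists>u v. s = {Orig u, Sub u v} \<and> n = L u v) \<or>
    (\<exists>u v. s = {Sub u v, Sub v u} \<and> n = Z {u, v}))" for s
  have f_outer: "f {Orig u, Sub u v} = L u v" for u v
    unfolding f_def by (rule the_equality) (auto simp: doubleton_eq_iff)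
  have f_middle: "f {Sub u v, Sub v u} = Z {u, v}" for u v
    unfolding f_def by (rule the_equality) (auto simp: doubleton_eq_iff insert_commute)

  have Z_range: "1 \<le> Z e" "Z e \<le> m" if "e \<in> edges G" for e
    using Z(2) that by auto
  have b_le: "b u v \<le> 1" if "{u, v} \<in> edges G" for u v
    using b[OF that] by simp
  have L_range: "m < L u v" "L u v \<le> 3 * m" if "{u, v} \<in> edges G" for u v
    using Z_range[OF that] b_le[OF that] by (auto simp: L_def)
  \<comment> \<open>\<open>Z\<close> identifies the edge, and \<open>b\<close> tells its two ends
    apart.\<close>
  have dart_eqI: "u = u' \<and> v = v'"
    if "{u, v} \<in> edges G" "{u', v'} \<in> edges G" "Z {u, v} = Z {u', v'}" "b u v = b u' v'"
    for u v u' v'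
  proof -
    have "{u, v} = {u', v'}"
      using Z(1) that by (simp add: inj_on_def)
    moreover have "b u v \<noteq> b v u"
      using b[OF that(1)] by presburger
    ultimately show ?thesis
      using that(4) by (auto simp: doubleton_eq_iff)
  qed
  \<comment> \<open>Injectivity of \<open>2 * z - c\<close> and \<open>3 * z - c\<close> in
    subtraction-free form, seen modulo 2 and 3: the first serves the outer labels, the second the
    sums at \<open>Sub\<close> vertices.\<close>
  have arith: "z = z' \<and> c = c'"
    if "2 * z + c' = 2 * z' + c \<or> 3 * z + c' = 3 * z' + c" "c \<le> 1" "c' \<le> 1" for z z' c c' :: nat
  proof -
    have "c = 0 \<or> c = 1" "c' = 0 \<or> c' = 1"
      using that by auto
    then show ?thesis
      using that(1) by (elim disjE) (simp_all, presburger+)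
  qed
  have L_inj: "u = u' \<and> v = v'"
    if "{u, v} \<in> edges G" "{u', v'} \<in> edges G" "L u v = L u' v'" for u v u' v'
  proof -
    have "Z {u, v} = Z {u', v'} \<and> b u v = b u' v'"
    proof (rule arith)
      show "2 * Z {u, v} + b u' v' = 2 * Z {u', v'} + b u v \<or>
        3 * Z {u, v} + b u' v' = 3 * Z {u', v'} + b u v"
        using that(3) Z_range(1)[OF that(1)] Z_range(1)[OF that(2)] b_le[OF that(1)] b_le[OF that(2)]
        unfolding L_def by linarith
    qed (use b_le that in auto)
    then show ?thesis
      using dart_eqI that by blast
  qed
  have LZ_inj: "u = u' \<and> v = v'"
    if "{u, v} \<in> edges G" "{u', v'} \<in> edges G" "L u v + Z {u, v} = L u' v' + Z {u', v'}"
    for u v u' v'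
  proof -
    have "Z {u, v} = Z {u', v'} \<and> b u v = b u' v'"
    proof (rule arith)
      show "2 * Z {u, v} + b u' v' = 2 * Z {u', v'} + b u v \<or>
        3 * Z {u, v} + b u' v' = 3 * Z {u', v'} + b u v"
        using that(3) Z_range(1)[OF that(1)] Z_range(1)[OF that(2)] b_le[OF that(1)] b_le[OF that(2)]
        unfolding L_def by linarith
    qed (use b_le that in auto)
    then show ?thesis
      using dart_eqI that by blast
  qed

  have edge_cases: "(\<exists>u v. {u, v} \<in> edges G \<and> s = {Orig u, Sub u v} \<and> f s = L u v) \<or>
      (\<exists>u v. {u, v} \<in> edges G \<and> s = {Sub u v, Sub v u} \<and> f s = Z {u, v})"
    if "s \<in> edges ?H" for s
    using that f_outer f_middle unfolding subdivision2_def by fastforce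
  have "inj_on f (edges ?H)"
  proof (rule inj_onI)
    fix s s' assume s: "s \<in> edges ?H" and s': "s' \<in> edges ?H" and eq: "f s = f s'"
    have ZZ: "{Sub u v, Sub v u} = {Sub u' v', Sub v' u'}"
      if "{u, v} \<in> edges G" "{u', v'} \<in> edges G" "Z {u, v} = Z {u', v'}" for u v u' v'
      using inj_onD[OF Z(1) that(3) that(1,2)] by (auto simp: doubleton_eq_iff)
    \<comment> \<open>The mixed case is impossible, since outer labels exceed \<open>m\<close> and
      middle ones do not.\<close>
    show "s = s'"
      using edge_cases[OF s] edge_cases[OF s'] eq L_inj ZZ L_range(1) Z_range(2)
      by (metis leD)
  qed
  moreover have "f ` edges ?H \<subseteq> {1..card (edges ?H)}"
  proof
    fix n assume "n \<in> f ` edges ?H"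
    then obtain s where s: "s \<in> edges ?H" "n = f s" by blast
    have "1 \<le> n \<and> n \<le> 3 * m"
      using edge_cases[OF s(1)]
    proof (elim disjE exE conjE)
      fix u v assume "{u, v} \<in> edges G" "f s = L u v"
      then show ?thesis using L_range[of u v] s(2) by simp
    next
      fix u v assume "{u, v} \<in> edges G" "f s = Z {u, v}"
      then show ?thesis using Z_range[of "{u, v}"] s(2) by simp
    qed
    then show "n \<in> {1..card (edges ?H)}"
      by (simp add: card_edges_subdivision2[OF simple] m_def)
  qed
  ultimately have bij: "bij_betw f (edges ?H) {1..card (edges ?H)}"
    by (intro bij_betw_imageI card_subset_eq) (simp_all add: card_image)

  have sum_Sub: "vertex_sum ?H f (Sub u v) = L u v + Z {u, v}" if "{u, v} \<in> edges G" for u v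
    by (simp add: vertex_sum_def incident_edges_Sub[OF that] f_outer f_middle doubleton_eq_iff)
  have sum_Sub_le: "vertex_sum ?H f (Sub u v) \<le> 4 * m" if "{u, v} \<in> edges G" for u v
    using sum_Sub[OF that] L_range[OF that] Z_range[OF that] by simp
  have deg_Sub: "degree ?H (Sub u v) = 2" if "{u, v} \<in> edges G" for u v
    by (simp add: degree_def incident_edges_Sub[OF that] doubleton_eq_iff)
  have inj_Orig: "inj_on (\<lambda>x. {Orig v, Sub v x}) A" for v :: 'a and A
    by (auto simp: inj_on_def doubleton_eq_iff)
  have nbrs: "card {x. {v, x} \<in> edges G} = 3" if "v \<in> verts G" for v
    using card_neighbours[OF simple] cubic that by (simp add: cubic_def)
  have deg_Orig: "degree ?H (Orig v) = 3" if "v \<in> verts G" for v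
    using nbrs[OF that] by (simp add: degree_def incident_edges_Orig card_image[OF inj_Orig])
  have sum_Orig: "\<exists>x. {v, x} \<in> edges G \<and> vertex_sum ?H f (Orig v) = 4 * m + 2 + L v x"
    if v: "v \<in> verts G" for v
  proof -
    let ?N = "{x. {v, x} \<in> edges G}"
    obtain u w where uw: "u \<noteq> w" "{v, u} \<in> edges G" "{v, w} \<in> edges G"
      "2 * Z {v, u} + 2 * Z {v, w} = 2 * m + 2 + b v u + b v w"
      using balanced[OF v] by blast
    have fin: "finite ?N"
      using nbrs[OF v] card.infinite by fastforce
    then have "card (?N - {u, w}) = 1"
      using nbrs[OF v] uw by (subst card_Diff_subset) auto
    then obtain x where x: "?N - {u, w} = {x}"
      using card_1_singletonE by blast
    then have N: "?N = {u, w, x}" and xE: "{v, x} \<in> edges G" and "x \<noteq> u" "x \<noteq> w"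
      using uw by auto
    have "L v u + L v w = 4 * m + 2"
      using uw(4) Z_range[OF uw(2)] Z_range[OF uw(3)] b_le[OF uw(2)] b_le[OF uw(3)]
      by (simp add: L_def)
    then have "(\<Sum>y\<in>?N. L v y) = 4 * m + 2 + L v x"
      unfolding N using \<open>x \<noteq> u\<close> \<open>x \<noteq> w\<close> uw(1) by simp
    moreover have "vertex_sum ?H f (Orig v) = (\<Sum>y\<in>?N. L v y)"
      by (simp add: vertex_sum_def incident_edges_Orig sum.reindex[OF inj_Orig] f_outer)
    ultimately show ?thesis using xE by auto
  qed
  have Sub_less_Orig: "vertex_sum ?H f (Sub u v) < vertex_sum ?H f (Orig w)"
    if "{u, v} \<in> edges G" "w \<in> verts G" for u v w
    using sum_Sub_le[OF that(1)] sum_Orig[OF that(2)] by auto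

  have vert_cases: "(\<exists>v\<in>verts G. p = Orig v) \<or> (\<exists>u v. {u, v} \<in> edges G \<and> p = Sub u v)"
    if "p \<in> verts ?H" for p
    using that by (auto simp: subdivision2_def)
  have "inj_on (vertex_sum ?H f) (verts ?H)"
  proof (rule inj_onI)
    fix p p' assume p: "p \<in> verts ?H" and p': "p' \<in> verts ?H"
      and eq: "vertex_sum ?H f p = vertex_sum ?H f p'"
    \<comment> \<open>Equal sums leave equal third labels, and by \<open>L_inj\<close> such a label
      determines its end \<open>v\<close>.\<close>
    have "v = v'" if "v \<in> verts G" "v' \<in> verts G"
      "vertex_sum ?H f (Orig v) = vertex_sum ?H f (Orig v')" for v v'
      using sum_Orig[OF that(1)] sum_Orig[OF that(2)] that(3) L_inj by force
    moreover have "Sub u v = Sub u' v'" if "{u, v} \<in> edges G" "{u', v'} \<in> edges G"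
      "vertex_sum ?H f (Sub u v) = vertex_sum ?H f (Sub u' v')" for u v u' v'
      using that LZ_inj by (simp add: sum_Sub)
    ultimately show "p = p'"
      using vert_cases[OF p] vert_cases[OF p'] eq Sub_less_Orig by (metis less_irrefl)
  qed
  \<comment> \<open>Only the degrees 2 and 3 occur, so \<open>p\<close> is a \<open>Sub\<close>
    vertex and \<open>p'\<close> an \<open>Orig\<close> vertex.\<close>
  moreover have "vertex_sum ?H f p < vertex_sum ?H f p'"
    if "p \<in> verts ?H" "p' \<in> verts ?H" "degree ?H p < degree ?H p'" for p p'
    using vert_cases[OF that(1)] vert_cases[OF that(2)] that(3) Sub_less_Orig
    by (auto simp: deg_Orig deg_Sub)
  ultimately have "strongly_antimagic_labeling ?H f"
    using bij by (simp add: strongly_antimagic_labeling_def antimagic_labeling_def)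
  then show ?thesis
    unfolding strongly_antimagic_def by blast
qed

theorem theorem2p3:
  fixes G :: "'a graph"
  assumes "simple_graph G" and "cubic G"
  shows "strongly_antimagic (subdivision2 G)"
proof -
  obtain xs where xs: "edge_listing (edges G) xs" "verts G \<subseteq> junctions xs"
    using ex_edge_listing_all_junctions[OF assms] by blast
  from ex_balanced_labels[OF assms(1) xs] obtain Z :: "'a set \<Rightarrow> nat" and b :: "'a \<Rightarrow> 'a \<Rightarrow> nat"
    where "inj_on Z (edges G)" "Z ` edges G \<subseteq> {1..card (edges G)}"
      "\<forall>u v. {u, v} \<in> edges G \<longrightarrow> b u v + b v u = 1"
      "\<forall>v\<in>verts G. \<exists>u w. u \<noteq> w \<and> {v, u} \<in> edges G \<and> {v, w} \<in> edges G \<and>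
         2 * Z {v, u} + 2 * Z {v, w} = 2 * card (edges G) + 2 + b v u + b v w"
    by (elim exE conjE)
  then show ?thesis
    by (intro strongly_antimagic_if_balanced_labels[OF assms, of Z b]) simp_all
qed

end
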